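(* Let $Y$ be a standard space and $q:Y\to X$ a quotient map with $X$ Hausdorff, and let $V$ be a minimal full subset of $Y$. Let $\rho$ be a metric for $Y$, let $Y=\bigcup_{n\ge1} Y_n$ be a compact decomposition of $Y$, and for $n,i\ge 1$ let $$d_n(v)=\sup\{ \rho (y, V): y\in Y_n,\ q(y)=q(v)\}\quad (v\in V),\qquad Z_{n,i}=\{ v\in V: d_n(v)\ge 1/i\},$$ where $d_n(v)=0$ if $q^{-1}(q(v))\cap Y_n=\emptyset$. Then the following are equivalent: (i) $V$ is the unique minimal full subset of $Y$; (ii) for each $n\ge 1$ and $i\ge 1$, $Z_{n,i}$ has empty interior in $V$; (iii) $V$ is the closure of the set of singleton fibres of $Y$.
   Context: A standard space is a locally compact separable metric space. A subset $W\subseteq Y$ is full if $W$ is closed and $q(W)=X$; a minimal full subset is a full subset that is minimal with respect to inclusion among full subsets. The set of singleton fibres of $Y$ is $\{y\in Y: q^{-1}(q(y))=\{y\}\}$. A compact decomposition of $Y$ is an increasing sequence $(Y_n)_{n\ge1}$ of compact subsets of $Y$ with union $Y$ such that each $Y_n$ is contained in the interior of $Y_{n+1}$. $\rho$ is a metric inducing the topology of $Y$, and $\rho(y,V)=\inf\{\rho(y,v):v\in V\}$. *)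

theory Defs
  imports "HOL-Analysis.Analysis"
begin

definition standard_space :: "'a topology \<Rightarrow> bool" where
  "standard_space Y \<longleftrightarrow> metrizable_space Y \<and> locally_compact_space Y \<and> separable_space Y"

definition metric_for :: "'a topology \<Rightarrow> ('a \<Rightarrow> 'a \<Rightarrow> real) \<Rightarrow> bool" where
  "metric_for Y \<rho> \<longleftrightarrow> Metric_space (topspace Y) \<rho> \<and> Metric_space.mtopology (topspace Y) \<rho> = Y"

definition full_subset :: "'a topology \<Rightarrow> 'b topology \<Rightarrow> ('a \<Rightarrow> 'b) \<Rightarrow> 'a set \<Rightarrow> bool" where
  "full_subset Y X q W \<longleftrightarrow> closedin Y W \<and> q ` W = topspace X"

definition minimal_full_subset :: "'a topology \<Rightarrow> 'b topology \<Rightarrow> ('a \<Rightarrow> 'b) \<Rightarrow> 'a set \<Rightarrow> bool" where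
  "minimal_full_subset Y X q V \<longleftrightarrow>
     full_subset Y X q V \<and> (\<forall>W. full_subset Y X q W \<and> W \<subseteq> V \<longrightarrow> W = V)"

definition singleton_fibres :: "'a topology \<Rightarrow> ('a \<Rightarrow> 'b) \<Rightarrow> 'a set" where
  "singleton_fibres Y q = {y \<in> topspace Y. {z \<in> topspace Y. q z = q y} = {y}}"

text \<open>The sequence is indexed from 1; the value of \<open>K\<close> at 0 is irrelevant.\<close>

definition compact_decomposition :: "'a topology \<Rightarrow> (nat \<Rightarrow> 'a set) \<Rightarrow> bool" where
  "compact_decomposition Y K \<longleftrightarrow>
     (\<forall>n\<ge>1. compactin Y (K n)) \<and>
     (\<forall>n\<ge>1. K n \<subseteq> K (Suc n)) \<and>
     (\<forall>n\<ge>1. K n \<subseteq> Y interior_of (K (Suc n))) \<and>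
     (\<Union>n\<in>{1..}. K n) = topspace Y"

text \<open>
  The infimum is meaningful for \<open>V\<close> nonempty, which holds wherever it is used below
  because there \<open>d\<^sub>n\<close> is evaluated at points of \<open>V\<close>.
\<close>

definition dist_to_set :: "('a \<Rightarrow> 'a \<Rightarrow> real) \<Rightarrow> 'a \<Rightarrow> 'a set \<Rightarrow> real" where
  "dist_to_set \<rho> y V = (INF v\<in>V. \<rho> y v)"

text \<open>
  In the next definition \<open>K\<close> plays the role of a single compact set \<open>Y\<^sub>n\<close>.  For \<open>v \<in> V\<close> the
  distances to \<open>V\<close> are bounded on \<open>K\<close>, so the real-valued supremum is the true one; the
  supremum of the empty set is set to 0 explicitly.
\<close>

definition fibre_excess ::
  "('a \<Rightarrow> 'b) \<Rightarrow> ('a \<Rightarrow> 'a \<Rightarrow> real) \<Rightarrow> 'a set \<Rightarrow> 'a set \<Rightarrow> 'a \<Rightarrow> real" where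
  "fibre_excess q \<rho> V K v =
     (if {y \<in> K. q y = q v} = {} then 0
      else (SUP y\<in>{y \<in> K. q y = q v}. dist_to_set \<rho> y V))"

definition excess_set ::
  "('a \<Rightarrow> 'b) \<Rightarrow> ('a \<Rightarrow> 'a \<Rightarrow> real) \<Rightarrow> 'a set \<Rightarrow> (nat \<Rightarrow> 'a set) \<Rightarrow> nat \<Rightarrow> nat \<Rightarrow> 'a set" where
  "excess_set q \<rho> V K n i = {v \<in> V. fibre_excess q \<rho> V (K n) v \<ge> 1 / real i}"

end

theory Submission
  imports Defs
begin

text \<open>
  Three ideas carry the proof.

  A singleton fibre lies in every full subset. So if the singleton fibres are dense in \<open>V\<close>, then
  \<open>V\<close> is contained in every full subset, and it is the only minimal one
  (\<open>unique_if_closure_singleton_fibres\<close>).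

  If the excess sets have empty interior in \<open>V\<close>, the Baire category theorem in the locally compact
  space \<open>V\<close> produces the singleton fibres. A point of \<open>V\<close> can fail to be a singleton fibre for two
  reasons: either its fibre leaves \<open>V\<close>, and then the point lies in some excess set, or its fibre meets
  \<open>V\<close> again. Both kinds of bad points form countable unions of closed subsets of \<open>V\<close>, closedness
  coming each time from the fact that the saturation of a compact set is closed when the target is
  Hausdorff. The second kind is always meagre, because minimality says that \<open>q\<close> restricted to \<open>V\<close> is
  irreducible: every nonempty open subset of \<open>V\<close> contains a whole fibre of that restriction
  (\<open>minimal_full_open_contains_fibre\<close>, \<open>minimal_full_repeated_fibres_nowhere_dense\<close>).

  Conversely, suppose that an excess set has nonempty interior \<open>U\<close>. The compact set \<open>C\<close> of points of
  \<open>Y\<^sub>n\<close> at distance at least \<open>1/i\<close> from \<open>V\<close> is disjoint from \<open>V\<close> and satisfies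
  \<open>q(U) \<subseteq> q(C)\<close>, so \<open>C\<close> can take over the fibres that \<open>U\<close> serves. Let \<open>E\<close> be the closure of the
  part of \<open>V\<close> lying outside the saturation of \<open>C\<close>, and let \<open>D\<close> be a minimal closed
  subset of \<open>C\<close> such that \<open>q\<close> maps \<open>E \<union> D\<close> onto \<open>X\<close>. Then \<open>E \<union> D\<close> is a minimal full subset missing \<open>U\<close>
  (\<open>another_minimal_full_subset\<close>). Zorn's lemma is applied only inside the compact set \<open>C\<close>; in a
  noncompact \<open>Y\<close> the intersection of a chain of full subsets need not be full.
\<close>

section \<open>Saturations of compact sets\<close>

lemma closedin_compact_saturation:
  assumes "Hausdorff_space X" "continuous_map Y X q" "compactin Y C"
  shows "closedin Y {y \<in> topspace Y. q y \<in> q ` C}"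
proof -
  have "closedin X (q ` C)"
    using assms compactin_imp_closedin image_compactin by blast
  then show ?thesis
    using assms(2) by (simp add: closedin_continuous_map_preimage)
qed

lemma closedin_fibre:
  assumes "Hausdorff_space X" "continuous_map Y X q" "y \<in> topspace Y"
  shows "closedin Y {z \<in> topspace Y. q z = q y}"
  using closedin_compact_saturation[of X Y q "{y}"] assms by simp

text \<open>
  Zorn's lemma, applied to the complements in \<open>C\<close> so that its maximal element is a minimal closed
  set. For a chain of closed subsets of \<open>C\<close> covering \<open>P\<close>, the intersection still covers \<open>P\<close>: the
  fibre over a point of \<open>P\<close> is closed and meets every member of the chain, hence meets the intersection
  by compactness of \<open>C\<close>.
\<close>

lemma compact_minimal_covering_subset:
  assumes X: "Hausdorff_space X" and q: "continuous_map Y X q"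
    and C: "compactin Y C" "closedin Y C" and P: "P \<subseteq> q ` C"
  obtains D where "closedin Y D" "D \<subseteq> C" "P \<subseteq> q ` D"
    "\<And>D'. \<lbrakk>closedin Y D'; D' \<subseteq> D; P \<subseteq> q ` D'\<rbrakk> \<Longrightarrow> D' = D"
proof -
  define \<A> where "\<A> = {C - D |D. closedin Y D \<and> D \<subseteq> C \<and> P \<subseteq> q ` D}"
  have "\<exists>M\<in>\<A>. \<forall>N\<in>\<A>. M \<subseteq> N \<longrightarrow> N = M"
  proof (rule subset_Zorn_nonempty)
    show "\<A> \<noteq> {}"
      using C P unfolding \<A>_def by blast
  next
    fix \<C> assume "\<C> \<noteq> {}" and ch: "subset.chain \<A> \<C>"
    define \<D> where "\<D> = (\<lambda>N. C - N) ` \<C>"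
    have \<C>: "\<C> \<subseteq> \<A>" and lin: "\<And>M N. \<lbrakk>M \<in> \<C>; N \<in> \<C>\<rbrakk> \<Longrightarrow> M \<subseteq> N \<or> N \<subseteq> M"
      using ch unfolding subset.chain_def by auto
    have \<D>: "closedin Y D \<and> D \<subseteq> C \<and> P \<subseteq> q ` D" if D: "D \<in> \<D>" for D
    proof -
      obtain N where "N \<in> \<C>" "D = C - N" using D unfolding \<D>_def by blast
      moreover obtain D' where "N = C - D'" "closedin Y D'" "D' \<subseteq> C" "P \<subseteq> q ` D'"
        using \<open>N \<in> \<C>\<close> \<C> unfolding \<A>_def by blast
      ultimately show ?thesis by (simp add: double_diff)
    qed
    have linD: "D \<subseteq> D' \<or> D' \<subseteq> D" if "D \<in> \<D>" "D' \<in> \<D>" for D D'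
      using that lin unfolding \<D>_def by blast
    have "\<D> \<noteq> {}" using \<open>\<C> \<noteq> {}\<close> by (simp add: \<D>_def)
    have least: "\<exists>D\<in>\<F>. D \<subseteq> \<Inter>\<F>" if "finite \<F>" "\<F> \<noteq> {}" "\<F> \<subseteq> \<D>" for \<F>
      using that
    proof (induction rule: finite_ne_induct)
      case (insert D \<F>)
      then obtain D' where "D' \<in> \<F>" "D' \<subseteq> \<Inter>\<F>" by auto
      then show ?case using linD[of D D'] insert.prems by auto
    qed auto
    have "P \<subseteq> q ` \<Inter>\<D>"
    proof
      fix p assume "p \<in> P"
      then obtain c where c: "c \<in> C" "q c = p" using P by blast
      define \<phi> where "\<phi> = {z \<in> topspace Y. q z = q c}"
      have "c \<in> topspace Y" using c C(2) closedin_subset by blast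
      then have clo: "closedin Y \<phi>" unfolding \<phi>_def by (rule closedin_fibre[OF X q])
      have "C \<inter> \<Inter> ((\<lambda>D. D \<inter> \<phi>) ` \<D>) \<noteq> {}"
      proof -
        have "\<forall>U\<in>(\<lambda>D. D \<inter> \<phi>) ` \<D>. closedin Y U"
          using \<D> clo by (auto intro: closedin_Int)
        moreover have "C \<inter> \<Inter>\<G> \<noteq> {}" if \<G>: "finite \<G>" "\<G> \<subseteq> (\<lambda>D. D \<inter> \<phi>) ` \<D>" for \<G>
        proof (cases "\<G> = {}")
          case True
          then show ?thesis using c by auto
        next
          case False
          obtain \<F> where \<F>: "finite \<F>" "\<F> \<subseteq> \<D>" "\<G> = (\<lambda>D. D \<inter> \<phi>) ` \<F>"
            using finite_subset_image[OF \<G>] by blast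
          then obtain D where D: "D \<in> \<F>" "D \<subseteq> \<Inter>\<F>" using least False by blast
          then obtain d where "d \<in> D" "q d = p"
            using \<D>[of D] \<F> \<open>p \<in> P\<close> by blast
          moreover have "d \<in> topspace Y"
            using \<D>[of D] D \<F> \<open>d \<in> D\<close> closedin_subset by blast
          ultimately have "d \<in> \<phi>" using c(2) by (simp add: \<phi>_def)
          moreover have "d \<in> C" using \<open>d \<in> D\<close> \<D>[of D] D(1) \<F>(2) by blast
          moreover have "d \<in> D'" if "D' \<in> \<F>" for D' using \<open>d \<in> D\<close> D(2) that by blast
          ultimately have "d \<in> C \<inter> \<Inter>\<G>" unfolding \<F>(3) by simp
          then show ?thesis by blast
        qed
        ultimately show ?thesis
          using C(1) unfolding compactin_fip by (metis (no_types, lifting))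
      qed
      then obtain d where d: "\<And>D. D \<in> \<D> \<Longrightarrow> d \<in> D \<and> d \<in> \<phi>" by blast
      then have "q d = p" using \<open>\<D> \<noteq> {}\<close> c unfolding \<phi>_def by blast
      then show "p \<in> q ` \<Inter>\<D>" using d by blast
    qed
    moreover have "closedin Y (\<Inter>\<D>)" "\<Inter>\<D> \<subseteq> C"
      using \<D> \<open>\<D> \<noteq> {}\<close> by (auto intro: closedin_Inter)
    moreover have "\<Union>\<C> = C - \<Inter>\<D>"
    proof -
      have "N \<subseteq> C" if "N \<in> \<C>" for N using that \<C> unfolding \<A>_def by blast
      then show ?thesis using \<open>\<C> \<noteq> {}\<close> unfolding \<D>_def by auto
    qed
    ultimately show "\<Union>\<C> \<in> \<A>" unfolding \<A>_def by blast
  qed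
  then obtain M where M: "M \<in> \<A>" "\<And>N. \<lbrakk>N \<in> \<A>; M \<subseteq> N\<rbrakk> \<Longrightarrow> N = M" by blast
  then obtain D where D: "M = C - D" "closedin Y D" "D \<subseteq> C" "P \<subseteq> q ` D"
    unfolding \<A>_def by blast
  show thesis
  proof
    fix D' assume "closedin Y D'" "D' \<subseteq> D" "P \<subseteq> q ` D'"
    then have "C - D' = C - D"
      using D M(2)[of "C - D'"] unfolding \<A>_def by blast
    then show "D' = D" using \<open>D' \<subseteq> D\<close> D by blast
  qed (use D in auto)
qed

section \<open>Minimal full subsets\<close>

lemma minimal_full_subsetD:
  assumes "minimal_full_subset Y X q V"
  shows "closedin Y V" "q ` V = topspace X" "V \<subseteq> topspace Y"
    "\<And>W. \<lbrakk>closedin Y W; W \<subseteq> V; topspace X \<subseteq> q ` W\<rbrakk> \<Longrightarrow> W = V"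
proof -
  show V: "closedin Y V" "q ` V = topspace X" "V \<subseteq> topspace Y"
    using assms closedin_subset unfolding minimal_full_subset_def full_subset_def by auto
  fix W assume W: "closedin Y W" "W \<subseteq> V" "topspace X \<subseteq> q ` W"
  then have "q ` W = topspace X" using V by blast
  then show "W = V"
    using W assms unfolding minimal_full_subset_def full_subset_def by blast
qed

text \<open>
  Irreducibility: deleting an open set \<open>U\<close> from \<open>V\<close> leaves a closed proper subset, which by
  minimality is not full, so some fibre inside \<open>V\<close> has been deleted entirely.
\<close>

lemma minimal_full_open_contains_fibre:
  assumes V: "minimal_full_subset Y X q V"
    and U: "openin (subtopology Y V) U" "U \<noteq> {}"
  obtains v where "v \<in> U" "{w \<in> V. q w = q v} \<subseteq> U"
proof -
  note VD = minimal_full_subsetD[OF V]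
  have "U \<subseteq> V" using U(1) openin_subset VD(3) by fastforce
  have "closedin (subtopology Y V) (V - U)"
    using U(1) VD(3) by (metis closedin_def closedin_diff closedin_topspace openin_closedin_eq
        topspace_subtopology_subset)
  then have "closedin Y (V - U)" using VD(1) closedin_trans_full by blast
  then have "\<not> topspace X \<subseteq> q ` (V - U)"
    using VD(4)[of "V - U"] U(2) \<open>U \<subseteq> V\<close> by blast
  then obtain v where "v \<in> V" "q v \<notin> q ` (V - U)" using VD(2) by (metis imageE subsetI)
  then have "w \<in> U" if "w \<in> V" "q w = q v" for w
    using that by (metis DiffI imageI)
  then have "v \<in> U" "{w \<in> V. q w = q v} \<subseteq> U" using \<open>v \<in> V\<close> by auto
  then show thesis by (rule that)
qed

text \<open>
  A localised form of minimality. If a full set \<open>W\<close> uses only points of \<open>V\<close> over the complement of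
  \<open>F\<close>, then it uses all of them, since otherwise those points of \<open>W\<close>, together with the part of \<open>V\<close> over
  \<open>F\<close>, would form a smaller full subset of \<open>V\<close>.
\<close>

lemma minimal_full_saturated_part:
  assumes V: "minimal_full_subset Y X q V" and W: "closedin Y W" "topspace X \<subseteq> q ` W"
    and clo: "closedin Y {y \<in> topspace Y. q y \<in> F}"
    and sub: "{w \<in> W. q w \<notin> F} \<subseteq> V"
  shows "{v \<in> V. q v \<notin> F} \<subseteq> W"
proof -
  note VD = minimal_full_subsetD[OF V]
  let ?T = "V \<inter> (W \<union> {y \<in> topspace Y. q y \<in> F})"
  have "?T = V"
  proof (rule VD(4))
    show "closedin Y ?T"
      using VD(1) W(1) clo by (intro closedin_Int closedin_Un)
    show "topspace X \<subseteq> q ` ?T"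
    proof
      fix x assume x: "x \<in> topspace X"
      show "x \<in> q ` ?T"
      proof (cases "x \<in> F")
        case True
        obtain v where "v \<in> V" "q v = x" using x unfolding VD(2)[symmetric] by blast
        then show ?thesis using True VD(3) by blast
      next
        case False
        obtain w where "w \<in> W" "q w = x" using x W(2) by blast
        then show ?thesis using False sub by blast
      qed
    qed
  qed auto
  then show ?thesis by blast
qed

text \<open>
  The set \<open>E\<close> is forced on any full subset of \<open>E \<union> D\<close>: over the complement of \<open>q(C)\<close> such a set has
  only points of \<open>V\<close> available, and minimality of \<open>V\<close> makes it use all of them. For this reason \<open>D\<close> is
  chosen after \<open>E\<close>, minimal for covering what \<open>E\<close> leaves over, and not minimal for covering \<open>q(C)\<close>:
  by taking the closure, \<open>E\<close> may acquire points that already lie over \<open>q(C)\<close>.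
\<close>

lemma another_minimal_full_subset:
  assumes X: "Hausdorff_space X" and q: "continuous_map Y X q"
    and V: "minimal_full_subset Y X q V"
    and C: "compactin Y C" "closedin Y C" "C \<inter> V = {}"
    and U: "openin (subtopology Y V) U" "U \<noteq> {}" "q ` U \<subseteq> q ` C"
  obtains W where "minimal_full_subset Y X q W" "W \<noteq> V"
proof -
  note VD = minimal_full_subsetD[OF V]
  define G where "G = {v \<in> V. q v \<notin> q ` C}"
  define E where "E = Y closure_of G"
  have clo: "closedin Y {y \<in> topspace Y. q y \<in> q ` C}"
    using X q C(1) by (rule closedin_compact_saturation)
  have E: "closedin Y E" "G \<subseteq> E" "E \<subseteq> V" "U \<inter> E = {}"
  proof -
    show "closedin Y E" by (simp add: E_def)
    show "G \<subseteq> E" unfolding E_def G_def using VD(3) by (intro closure_of_subset) auto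
    show "E \<subseteq> V" unfolding E_def G_def by (intro closure_of_minimal VD(1)) auto
    obtain T where T: "openin Y T" "U = T \<inter> V" using U(1) openin_subtopology by metis
    then have "T \<inter> G = {}" using U(3) unfolding G_def by blast
    then have "T \<inter> E = {}" unfolding E_def using T(1) openin_Int_closure_of_eq_empty by metis
    then show "U \<inter> E = {}" using T by blast
  qed
  have "topspace X - q ` E \<subseteq> q ` C"
  proof
    fix x assume x: "x \<in> topspace X - q ` E"
    then obtain v where "v \<in> V" "q v = x" using x unfolding VD(2)[symmetric] by blast
    then show "x \<in> q ` C" using x E(2) unfolding G_def by blast
  qed
  then obtain D where D: "closedin Y D" "D \<subseteq> C" "topspace X - q ` E \<subseteq> q ` D"
    "\<And>D'. \<lbrakk>closedin Y D'; D' \<subseteq> D; topspace X - q ` E \<subseteq> q ` D'\<rbrakk> \<Longrightarrow> D' = D"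
    using compact_minimal_covering_subset[OF X q C(1,2)] by metis
  have Wsub: "E \<union> D \<subseteq> topspace Y"
    using E(1) D(1) closedin_subset by blast
  have "q ` (E \<union> D) \<subseteq> topspace X"
    using Wsub continuous_map_image_subset_topspace[OF q] by blast
  moreover have "topspace X \<subseteq> q ` (E \<union> D)"
    using D(3) by blast
  ultimately have "q ` (E \<union> D) = topspace X" by (rule subset_antisym)
  then have "full_subset Y X q (E \<union> D)"
    unfolding full_subset_def using E(1) D(1) by auto
  moreover have "W = E \<union> D" if W: "full_subset Y X q W" "W \<subseteq> E \<union> D" for W
  proof -
    have W': "closedin Y W" "q ` W = topspace X" using W(1) unfolding full_subset_def by auto
    have "{w \<in> W. q w \<notin> q ` C} \<subseteq> V"
      using W(2) D(2) E(3) by blast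
    then have "G \<subseteq> W"
      unfolding G_def
      using minimal_full_saturated_part[OF V W'(1) equalityD2[OF W'(2)] clo] by simp
    then have "E \<subseteq> W" unfolding E_def using W'(1) by (rule closure_of_minimal)
    have "W \<inter> D = D"
    proof (rule D(4))
      show "closedin Y (W \<inter> D)" using W'(1) D(1) by auto
      show "topspace X - q ` E \<subseteq> q ` (W \<inter> D)"
        using W(2) unfolding W'(2)[symmetric] by blast
    qed auto
    then show ?thesis using \<open>E \<subseteq> W\<close> W(2) by blast
  qed
  ultimately have "minimal_full_subset Y X q (E \<union> D)"
    unfolding minimal_full_subset_def by blast
  moreover have "E \<union> D \<noteq> V"
  proof -
    obtain u where "u \<in> U" using U(2) by blast
    then have "u \<in> V" using U(1) openin_subset by fastforce
    then show ?thesis using \<open>u \<in> U\<close> E(4) D(2) C(3) by blast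
  qed
  ultimately show thesis using that by blast
qed

text \<open>
  By irreducibility, a nonempty open set of such points would contain a whole fibre of \<open>q\<close> restricted
  to \<open>V\<close>, and that fibre would lie in \<open>A\<close> and yet meet \<open>B\<close>.
\<close>

lemma minimal_full_repeated_fibres_nowhere_dense:
  assumes X: "Hausdorff_space X" and q: "continuous_map Y X q"
    and V: "minimal_full_subset Y X q V"
    and A: "closedin Y A" and B: "compactin Y B" "A \<inter> B = {}"
  shows "closedin (subtopology Y V) {v \<in> V \<inter> A. q v \<in> q ` (V \<inter> B)}"
    and "subtopology Y V interior_of {v \<in> V \<inter> A. q v \<in> q ` (V \<inter> B)} = {}"
proof -
  note VD = minimal_full_subsetD[OF V]
  let ?R = "{v \<in> V \<inter> A. q v \<in> q ` (V \<inter> B)}"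
  have "compactin Y (V \<inter> B)" using VD(1) B(1) by (rule closed_Int_compactin)
  then have "closedin Y {y \<in> topspace Y. q y \<in> q ` (V \<inter> B)}"
    using X q closedin_compact_saturation by blast
  then have "closedin Y (A \<inter> {y \<in> topspace Y. q y \<in> q ` (V \<inter> B)})"
    using A by blast
  moreover have "?R = (A \<inter> {y \<in> topspace Y. q y \<in> q ` (V \<inter> B)}) \<inter> V"
    using VD(3) by blast
  ultimately show "closedin (subtopology Y V) ?R"
    using closedin_subtopology by blast
  show "subtopology Y V interior_of ?R = {}"
  proof (rule ccontr)
    assume ne: "subtopology Y V interior_of ?R \<noteq> {}"
    then obtain v where v: "v \<in> subtopology Y V interior_of ?R"
      "{w \<in> V. q w = q v} \<subseteq> subtopology Y V interior_of ?R"
      using minimal_full_open_contains_fibre[OF V openin_interior_of ne] by blast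
    then have "v \<in> ?R" "{w \<in> V. q w = q v} \<subseteq> A"
      using interior_of_subset[of "subtopology Y V" ?R] by auto
    then show False using B(2) by auto
  qed
qed

section \<open>The distance to a closed set\<close>

context Metric_space
begin

lemma dist_to_set_le:
  assumes "V \<subseteq> M" "y \<in> M" "v \<in> V"
  shows "dist_to_set d y V \<le> d y v"
  unfolding dist_to_set_def using assms by (intro cINF_lower bdd_belowI2[where m=0]) auto

lemma dist_to_set_triangle:
  assumes "V \<subseteq> M" "V \<noteq> {}" "y \<in> M" "z \<in> M"
  shows "dist_to_set d y V \<le> d y z + dist_to_set d z V"
proof -
  have "dist_to_set d y V - d y z \<le> d z v" if "v \<in> V" for v
    using dist_to_set_le[OF assms(1,3) that] triangle[of y z v] assms that by fastforce
  then have "dist_to_set d y V - d y z \<le> dist_to_set d z V"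
    unfolding dist_to_set_def[of d z] using assms(2) by (intro cINF_greatest) auto
  then show ?thesis by simp
qed

lemma continuous_map_dist_to_set:
  assumes "V \<subseteq> M" "V \<noteq> {}"
  shows "continuous_map mtopology euclideanreal (\<lambda>y. dist_to_set d y V)"
proof -
  have *: "\<bar>dist_to_set d y V - dist_to_set d z V\<bar> \<le> d y z" if "y \<in> M" "z \<in> M" for y z
    using dist_to_set_triangle[OF assms that] dist_to_set_triangle[OF assms that(2,1)]
      commute[of y z] by linarith
  have "continuous_map mtopology Met_TC.mtopology (\<lambda>y. dist_to_set d y V)"
    unfolding metric_continuous_map[OF Met_TC.Metric_space_axioms]
  proof (intro conjI ballI allI impI)
    fix a \<epsilon> :: real and b assume "b \<in> M" "\<epsilon> > 0"
    then show "\<exists>\<delta>>0. \<forall>x. x \<in> M \<and> d b x < \<delta> \<longrightarrow> dist (dist_to_set d b V) (dist_to_set d x V) < \<epsilon>"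
      using * by (intro exI[of _ \<epsilon>]) (fastforce simp: dist_real_def)
  qed auto
  then show ?thesis by simp
qed

lemma dist_to_set_pos:
  assumes "closedin mtopology V" "V \<noteq> {}" "y \<in> M" "y \<notin> V"
  shows "dist_to_set d y V > 0"
proof -
  obtain r where r: "r > 0" "disjnt V (mball y r)"
    using assms unfolding closedin_metric by blast
  have "r \<le> dist_to_set d y V"
    unfolding dist_to_set_def
  proof (rule cINF_greatest[OF assms(2)])
    fix v assume "v \<in> V"
    moreover have "v \<in> M" using assms(1) \<open>v \<in> V\<close> closedin_metric by blast
    ultimately show "r \<le> d y v" using r(2) assms(3) unfolding disjnt_iff by force
  qed
  then show ?thesis using r(1) by linarith
qed

text \<open>
  The supremum defining the excess is attained, because the fibre is closed and its part in \<open>K\<close> is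
  therefore compact. Positivity of \<open>c\<close> excludes the conventional value \<open>0\<close> for an empty fibre.
\<close>

lemma fibre_excess_ge_iff:
  assumes X: "Hausdorff_space X" and q: "continuous_map mtopology X q"
    and K: "compactin mtopology K" and V: "V \<subseteq> M" "v \<in> V" and "c > 0"
  shows "fibre_excess q d V K v \<ge> c \<longleftrightarrow> (\<exists>y\<in>K. q y = q v \<and> dist_to_set d y V \<ge> c)"
proof (cases "{y \<in> K. q y = q v} = {}")
  case True
  then show ?thesis using \<open>c > 0\<close> by (auto simp: fibre_excess_def)
next
  case False
  let ?S = "{y \<in> K. q y = q v}" and ?f = "\<lambda>y. dist_to_set d y V"
  have "K \<subseteq> M" using K compactin_subset_topspace by fastforce
  then have "?S = {z \<in> topspace mtopology. q z = q v} \<inter> K" by auto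
  then have "compactin mtopology ?S"
    using closed_Int_compactin[OF closedin_fibre[OF X q] K] V by auto
  then have "compact (?f ` ?S)"
    using image_compactin[OF _ continuous_map_dist_to_set[of V]] V by auto
  then obtain s where s: "s \<in> ?S" "\<And>y. y \<in> ?S \<Longrightarrow> ?f y \<le> ?f s"
    using False compact_attains_sup[of "?f ` ?S"] by blast
  then have "(SUP y\<in>?S. ?f y) = ?f s"
    by (intro cSup_eq_maximum) auto
  then have "fibre_excess q d V K v = ?f s"
    unfolding fibre_excess_def if_not_P[OF False] .
  then show ?thesis using s by (auto intro: order_trans)
qed

text \<open>
  This form gives both properties of excess sets that matter: they are closed in \<open>V\<close>, and their
  images under \<open>q\<close> lie in the image of a compact set disjoint from \<open>V\<close>.
\<close>

lemma excess_set_eq_saturation: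
  assumes X: "Hausdorff_space X" and q: "continuous_map mtopology X q"
    and K: "compactin mtopology (K n)" and V: "V \<subseteq> M" and "i \<ge> 1"
  shows "excess_set q d V K n i = {v \<in> V. q v \<in> q ` {y \<in> K n. dist_to_set d y V \<ge> 1 / real i}}"
proof -
  have "1 / real i \<le> fibre_excess q d V (K n) v \<longleftrightarrow>
      q v \<in> q ` {y \<in> K n. dist_to_set d y V \<ge> 1 / real i}" if "v \<in> V" for v
    using fibre_excess_ge_iff[OF X q K V that, of "1 / real i"] \<open>i \<ge> 1\<close>
    by (auto simp: image_iff eq_commute)
  then show ?thesis unfolding excess_set_def by blast
qed

lemma compactin_far_from_set:
  assumes "compactin mtopology K" "V \<subseteq> M" "V \<noteq> {}"
  shows "compactin mtopology {y \<in> K. dist_to_set d y V \<ge> c}"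
proof -
  have "closedin mtopology {y \<in> topspace mtopology. dist_to_set d y V \<in> {c..}}"
    by (rule closedin_continuous_map_preimage[OF continuous_map_dist_to_set[OF assms(2,3)]]) auto
  from closed_Int_compactin[OF this assms(1)] show ?thesis
    using compactin_subset_topspace[OF assms(1)]
    by (auto elim!: back_subst[of "compactin mtopology"])
qed

text \<open>
  Reduces the uncountably many pairs of distinct points to countably many pairs of disjoint closed
  sets, as needed to apply the Baire category theorem to the repeated fibres.
\<close>

lemma separate_points_by_countable_family:
  assumes S: "S \<subseteq> M" "mtopology closure_of S = M" and "v \<in> M" "w \<in> M" "v \<noteq> w"
  obtains a m where "a \<in> S" "v \<in> M - mball a (2 / real (Suc m))"
    "w \<in> mcball a (1 / real (Suc m))"
proof -
  have "d v w > 0" using assms by simp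
  \<comment> \<open>With radius \<open>r < d v w / 3\<close> and \<open>d w a < r\<close>, the point \<open>v\<close> is at distance more than \<open>2r\<close> from \<open>a\<close>.\<close>
  then obtain m where m: "1 / real (Suc m) < d v w / 3"
    using reals_Archimedean[of "d v w / 3"] by (auto simp: inverse_eq_divide)
  have pos: "1 / real (Suc m) > 0" by simp
  have "w \<in> mtopology closure_of S" using S assms by simp
  then obtain a where a: "a \<in> S" "a \<in> mball w (1 / real (Suc m))"
    using pos unfolding metric_closure_of by blast
  moreover have "d v w \<le> d v a + d a w" using a assms S by (auto intro: triangle)
  ultimately have "d a v \<ge> 2 / real (Suc m)" "d a w \<le> 1 / real (Suc m)" "a \<in> M"
    using m commute[of a w] commute[of a v] by auto
  then show thesis using that[of a m] a assms by auto
qed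

end

section \<open>Uniqueness, excess sets and singleton fibres\<close>

lemma singleton_fibres_subset_full:
  assumes "full_subset Y X q W" "continuous_map Y X q"
  shows "singleton_fibres Y q \<subseteq> W"
proof
  fix y assume y: "y \<in> singleton_fibres Y q"
  then have "q y \<in> q ` W"
    using assms continuous_map_image_subset_topspace
    unfolding full_subset_def singleton_fibres_def by fastforce
  then obtain w where "w \<in> W" "q w = q y" by auto
  moreover have "w \<in> topspace Y"
    using \<open>w \<in> W\<close> assms(1) closedin_subset unfolding full_subset_def by blast
  ultimately have "w \<in> {z \<in> topspace Y. q z = q y}" by simp
  also have "\<dots> = {y}" using y unfolding singleton_fibres_def by simp
  finally show "y \<in> W" using \<open>w \<in> W\<close> by simp
qed

lemma unique_if_closure_singleton_fibres:
  assumes q: "continuous_map Y X q" and V: "minimal_full_subset Y X q V"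
    and eq: "V = Y closure_of (singleton_fibres Y q)"
  shows "minimal_full_subset Y X q W \<longleftrightarrow> W = V"
proof
  assume W: "minimal_full_subset Y X q W"
  then have W': "full_subset Y X q W" unfolding minimal_full_subset_def by blast
  then have "V \<subseteq> W"
    unfolding eq using singleton_fibres_subset_full[OF W' q]
    by (intro closure_of_minimal) (auto simp: full_subset_def)
  then show "W = V"
    using W V unfolding minimal_full_subset_def by blast
qed (use V in simp)

lemma excess_sets_thin_if_unique:
  assumes M: "Metric_space M d" and X: "Hausdorff_space X"
    and q: "continuous_map (Metric_space.mtopology M d) X q"
    and V: "minimal_full_subset (Metric_space.mtopology M d) X q V"
    and K: "compactin (Metric_space.mtopology M d) (K n)" and i: "i \<ge> 1"
    and uniq: "\<And>W. minimal_full_subset (Metric_space.mtopology M d) X q W \<Longrightarrow> W = V"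
  shows "subtopology (Metric_space.mtopology M d) V interior_of (excess_set q d V K n i) = {}"
    (is "?I = {}")
proof (rule ccontr)
  interpret Metric_space M d by (rule M)
  assume ne: "?I \<noteq> {}"
  have "V \<subseteq> M" using minimal_full_subsetD(3)[OF V] by simp
  let ?C = "{y \<in> K n. dist_to_set d y V \<ge> 1 / real i}"
  have I: "?I \<subseteq> excess_set q d V K n i" by (rule interior_of_subset)
  then have "V \<noteq> {}" using ne unfolding excess_set_def by blast
  have C: "compactin mtopology ?C"
    using compactin_far_from_set[OF K \<open>V \<subseteq> M\<close> \<open>V \<noteq> {}\<close>] .
  have "?C \<inter> V = {}"
  proof -
    have "dist_to_set d y V \<le> 0" if "y \<in> V" for y
      using dist_to_set_le[of V y y] that \<open>V \<subseteq> M\<close> by auto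
    moreover have "1 / real i > 0" using i by simp
    ultimately show ?thesis by (smt (verit) disjoint_iff mem_Collect_eq)
  qed
  moreover have "q ` ?I \<subseteq> q ` ?C"
    using I excess_set_eq_saturation[where K = K and n = n, OF X q K \<open>V \<subseteq> M\<close> i] by blast
  ultimately obtain W where "minimal_full_subset mtopology X q W" "W \<noteq> V"
    using another_minimal_full_subset[OF X q V C
        compactin_imp_closedin[OF Hausdorff_space_mtopology C] _ openin_interior_of ne] by metis
  then show False using uniq by blast
qed

text \<open>
  The Baire argument. The family \<open>\<G>\<close> consists of the excess sets and of the sets \<open>R (a, m, n)\<close> of
  points whose fibre meets \<open>V\<close> again in a small ball around \<open>a\<close>, the points themselves staying away
  from that ball; intersecting the ball with the compact set \<open>K n\<close> makes these sets closed.
\<close>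

lemma closure_singleton_fibres_if_excess_sets_thin:
  assumes M: "Metric_space M d"
    and loc: "locally_compact_space (Metric_space.mtopology M d)"
    and sep: "separable_space (Metric_space.mtopology M d)"
    and X: "Hausdorff_space X" and q: "continuous_map (Metric_space.mtopology M d) X q"
    and V: "minimal_full_subset (Metric_space.mtopology M d) X q V"
    and K: "\<And>n. n \<ge> 1 \<Longrightarrow> compactin (Metric_space.mtopology M d) (K n)"
      "(\<Union>n\<in>{1..}. K n) = M"
    and thin: "\<And>n i. \<lbrakk>n \<ge> 1; i \<ge> 1\<rbrakk> \<Longrightarrow>
      subtopology (Metric_space.mtopology M d) V interior_of (excess_set q d V K n i) = {}"
  shows "V = Metric_space.mtopology M d closure_of (singleton_fibres (Metric_space.mtopology M d) q)"
    (is "V = _ closure_of ?S")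
proof -
  interpret Metric_space M d by (rule M)
  note VD = minimal_full_subsetD[OF V]
  have "V \<subseteq> M" using VD(3) by simp
  let ?Z = "subtopology mtopology V"
  obtain Q where Q: "countable Q" "Q \<subseteq> M" "mtopology closure_of Q = M"
    using sep unfolding separable_space_def by auto
  define R where "R = (\<lambda>(a, m, n). {v \<in> V \<inter> (M - mball a (2 / real (Suc m))).
      q v \<in> q ` (V \<inter> (mcball a (1 / real (Suc m)) \<inter> K n))})"
  define \<G> where "\<G> = (\<lambda>(n, i). excess_set q d V K n i) ` ({1..} \<times> {1..}) \<union>
    R ` (Q \<times> UNIV \<times> {1..})"
  have "?Z interior_of \<Union>\<G> = {}"
  proof (rule Baire_category_alt)
    show "completely_metrizable_space ?Z \<or> locally_compact_space ?Z \<and> regular_space ?Z"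
      using loc VD(1) locally_compact_space_closed_subset regular_space_subtopology
        regular_space_mtopology by blast
    show "countable \<G>" unfolding \<G>_def using Q(1) by auto
    show "closedin ?Z T \<and> ?Z interior_of T = {}" if T: "T \<in> \<G>" for T
    proof -
      consider n i where "n \<ge> 1" "i \<ge> 1" "T = excess_set q d V K n i"
        | a m n where "n \<ge> 1" "T = R (a, m, n)"
        using T unfolding \<G>_def by auto
      then show ?thesis
      proof cases
        case 1
        have "closedin ?Z (excess_set q d V K n i)"
        proof (cases "V = {}")
          case True
          then show ?thesis by (simp add: excess_set_def)
        next
          case False
          note eq = excess_set_eq_saturation[where K = K and n = n, OF X q K(1)[OF 1(1)] \<open>V \<subseteq> M\<close> 1(2)]
          let ?C = "{y \<in> K n. dist_to_set d y V \<ge> 1 / real i}"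
          have "closedin mtopology {y \<in> topspace mtopology. q y \<in> q ` ?C}"
            by (rule closedin_compact_saturation[OF X q
                  compactin_far_from_set[OF K(1)[OF 1(1)] \<open>V \<subseteq> M\<close> False]])
          moreover have "excess_set q d V K n i = {y \<in> topspace mtopology. q y \<in> q ` ?C} \<inter> V"
            unfolding eq using \<open>V \<subseteq> M\<close> by auto
          ultimately show ?thesis using closedin_subtopology by blast
        qed
        then show ?thesis using thin 1 by simp
      next
        case 2
        have A: "closedin mtopology (M - mball a (2 / real (Suc m)))"
          using closedin_diff[OF closedin_topspace openin_mball] by simp
        have B: "compactin mtopology (mcball a (1 / real (Suc m)) \<inter> K n)"
          using K(1)[OF 2(1)] by (intro closed_Int_compactin) auto
        have "1 / real (Suc m) < 2 / real (Suc m)" by (simp add: divide_strict_right_mono)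
        then have "(M - mball a (2 / real (Suc m))) \<inter> (mcball a (1 / real (Suc m)) \<inter> K n) = {}"
          by (auto simp del: of_nat_Suc)
        from minimal_full_repeated_fibres_nowhere_dense[OF X q V A B this]
        show ?thesis unfolding 2(2) R_def by simp
      qed
    qed
  qed
  moreover have cover: "V - ?S \<subseteq> \<Union>\<G>"
  proof
    fix v assume v: "v \<in> V - ?S"
    then have "v \<in> M" using \<open>V \<subseteq> M\<close> by blast
    then obtain w where w: "w \<in> M" "q w = q v" "w \<noteq> v"
      using v unfolding singleton_fibres_def by auto
    then obtain n where n: "n \<ge> 1" "w \<in> K n" using K(2) by blast
    show "v \<in> \<Union>\<G>"
    proof (cases "w \<in> V")
      case True
      obtain a m where am: "a \<in> Q" "v \<in> M - mball a (2 / real (Suc m))"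
        "w \<in> mcball a (1 / real (Suc m))"
        using separate_points_by_countable_family[OF Q(2,3) \<open>v \<in> M\<close> w(1)] w(3) by metis
      have "q v \<in> q ` (V \<inter> (mcball a (1 / real (Suc m)) \<inter> K n))"
        using True n(2) am(3) w(2) by (intro image_eqI[of _ _ w]) auto
      then have "v \<in> R (a, m, n)" using v am(2) unfolding R_def by simp
      moreover have "R (a, m, n) \<in> \<G>" using am(1) n(1) unfolding \<G>_def by blast
      ultimately show ?thesis by blast
    next
      case False
      then have "dist_to_set d w V > 0"
        using dist_to_set_pos[OF VD(1)] v w by blast
      then obtain j where "1 / real (Suc j) < dist_to_set d w V"
        using reals_Archimedean by (auto simp: inverse_eq_divide)
      then have "v \<in> excess_set q d V K n (Suc j)"
        using excess_set_eq_saturation[where K = K and n = n, OF X q K(1)[OF n(1)] \<open>V \<subseteq> M\<close>, of "Suc j"] v w n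
        by (auto simp: image_iff simp del: of_nat_Suc intro!: bexI[of _ w])
      moreover have "excess_set q d V K n (Suc j) \<in> \<G>" using n(1) unfolding \<G>_def by force
      ultimately show ?thesis by blast
    qed
  qed
  ultimately have thin': "?Z interior_of (V - ?S) = {}"
    using interior_of_mono by blast
  have "?S \<subseteq> V"
    using singleton_fibres_subset_full[OF _ q] V unfolding minimal_full_subset_def by blast
  have "V \<subseteq> mtopology closure_of ?S"
  proof
    fix v assume "v \<in> V"
    show "v \<in> mtopology closure_of ?S"
      unfolding in_closure_of
    proof (intro conjI allI impI)
      show "v \<in> topspace mtopology" using \<open>v \<in> V\<close> VD(3) by blast
      fix T assume T: "v \<in> T \<and> openin mtopology T"
      show "\<exists>y. y \<in> ?S \<and> y \<in> T"
      proof (rule ccontr)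
        assume "\<not> ?thesis"
        then have "T \<inter> V \<subseteq> V - ?S" by blast
        moreover have "openin ?Z (T \<inter> V)" using T openin_subtopology by blast
        ultimately show False
          using thin' T \<open>v \<in> V\<close> interior_of_maximal by blast
      qed
    qed
  qed
  moreover have "mtopology closure_of ?S \<subseteq> V"
    by (rule closure_of_minimal[OF \<open>?S \<subseteq> V\<close> VD(1)])
  ultimately show ?thesis by blast
qed

theorem theorem3p6:
  fixes Y :: "'a topology" and X :: "'b topology" and q :: "'a \<Rightarrow> 'b"
    and V :: "'a set" and \<rho> :: "'a \<Rightarrow> 'a \<Rightarrow> real" and K :: "nat \<Rightarrow> 'a set"
  assumes "standard_space Y" and "Hausdorff_space X" and "quotient_map Y X q"
    and "minimal_full_subset Y X q V"
    and "metric_for Y \<rho>"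
    and "compact_decomposition Y K"
  shows "((\<forall>W. minimal_full_subset Y X q W \<longleftrightarrow> W = V) \<longleftrightarrow>
           (\<forall>n\<ge>1. \<forall>i\<ge>1. (subtopology Y V) interior_of (excess_set q \<rho> V K n i) = {})) \<and>
         ((\<forall>n\<ge>1. \<forall>i\<ge>1. (subtopology Y V) interior_of (excess_set q \<rho> V K n i) = {}) \<longleftrightarrow>
           V = Y closure_of (singleton_fibres Y q))"
    (is "(?i \<longleftrightarrow> ?ii) \<and> (?ii \<longleftrightarrow> ?iii)")
proof -
  have M: "Metric_space (topspace Y) \<rho>"
    and Y: "Metric_space.mtopology (topspace Y) \<rho> = Y"
    using assms(5) unfolding metric_for_def by auto
  have q: "continuous_map Y X q" using assms(3) by (rule quotient_imp_continuous_map)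
  have K: "\<And>n. n \<ge> 1 \<Longrightarrow> compactin Y (K n)" "(\<Union>n\<in>{1..}. K n) = topspace Y"
    using assms(6) unfolding compact_decomposition_def by auto
  have "?ii" if ?i
  proof (intro allI impI)
    fix n i :: nat assume "1 \<le> n" "1 \<le> i"
    show "subtopology Y V interior_of excess_set q \<rho> V K n i = {}"
      by (rule excess_sets_thin_if_unique[OF M, unfolded Y, OF assms(2) q assms(4)])
        (use K(1) \<open>1 \<le> n\<close> \<open>1 \<le> i\<close> \<open>?i\<close> in auto)
  qed
  moreover have "?iii" if ?ii
    by (rule closure_singleton_fibres_if_excess_sets_thin[OF M, unfolded Y,
          where X = X and K = K])
      (use that K q assms(1,2,4) in \<open>auto simp: standard_space_def\<close>)
  moreover have "?i" if ?iii
    using unique_if_closure_singleton_fibres[OF q assms(4) that] by blast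
  ultimately show ?thesis by argo
qed

end
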